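(* Let $(W,S)$ be a Coxeter system. If $(W,S)$ is finite, then any $W$-digraph is acyclic. Further, if $(W,S)$ is finite, the number of sources (or sinks) in a finite $W$-digraph is equal to the number of its connected components.
   Context: Coxeter system: $W$ has presentation $\langle s\in S\mid (rs)^{n(r,s)}=e \text{ for } r,s\in S,\ n(r,s)<\infty\rangle$ with $n(s,s)=1$ and $1<n(r,s)=n(s,r)\le\infty$ for $r\ne s$; $\ell$ is the length function. "$(W,S)$ is finite" means $W$ is finite. Hecke algebra: $u$ is an indeterminate and $H$ is the $\mathbb Q(u)$-algebra with basis $\{T_w\mid w\in W\}$ satisfying, for $s\in S$, $T_sT_w=T_{sw}$ if $\ell(sw)>\ell(w)$ and $T_sT_w=u^2T_{sw}+(u^2-1)T_w$ if $\ell(sw)<\ell(w)$. An $S$-labeled digraph is a directed multigraph $\Gamma$ with vertex set $\mathscr V(\Gamma)$ and edge set $\mathscr E(\Gamma)$, in which every edge is either solid or dashed and is labeled by an element of $S$ (written $\alpha\xrightarrow{s}\beta$ if solid, $\alpha\overset{s}{\dashrightarrow}\beta$ if dashed), such that $\Gamma$ has no loops and, for each $s\in S$, every vertex occurs in exactly one edge labeled $s$. It is finite if $\mathscr V(\Gamma)$ is finite. Let $M(\Gamma)$ be the $\mathbb Q(u)$-vector space with basis $\mathscr V(\Gamma)$. For $s\in S$ let $\tau_s$ be the linear operator on $M(\Gamma)$ with, for each vertex $\alpha$ (where $\beta$ is the other endpoint of the edge labeled $s$ at $\alpha$): $\tau_s(\alpha)=\beta$ if the edge is $\alpha\xrightarrow{s}\beta$;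 $\tau_s(\alpha)=(u^2-1)\alpha+u^2\beta$ if it is $\beta\xrightarrow{s}\alpha$; $\tau_s(\alpha)=u\alpha+(u+1)\beta$ if it is $\alpha\overset{s}{\dashrightarrow}\beta$; $\tau_s(\alpha)=(u^2-u-1)\alpha+(u^2-u)\beta$ if it is $\beta\overset{s}{\dashrightarrow}\alpha$. An $S$-labeled digraph $\Gamma$ is a $W$-digraph if $T_s\mapsto\tau_s$ ($s\in S$) extends to a homomorphism of $\mathbb Q(u)$-algebras from $H$ to the algebra of all linear operators on $M(\Gamma)$. Ignoring types and labels of edges gives a directed multigraph: a source (sink) of $\Gamma$ is a vertex with no incoming (no outgoing) edges; $\Gamma$ is acyclic if it has no nonempty directed circuit; connected components are those of the underlying undirected multigraph. *)

theory Defs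
  imports
    "HOL-Algebra.Generated_Groups"
    "HOL-Algebra.Module"
    "HOL-Algebra.Algebraic_Closure_Type"
    "HOL-Library.Extended_Nat"
    "HOL-Computational_Algebra.Polynomial"
    "HOL-Computational_Algebra.Fraction_Field"
    "Graph_Theory.Digraph"
    "Graph_Theory.Digraph_Component"
    "Graph_Theory.Arc_Walk"
begin

section \<open>Presentations and Coxeter systems\<close>

text \<open>A letter \<open>(x, True)\<close> stands for the generator \<open>x\<close>, and \<open>(x, False)\<close> for its formal inverse.\<close>

fun eval_word :: "('g, 'm) monoid_scheme \<Rightarrow> ('g \<times> bool) list \<Rightarrow> 'g" where
  "eval_word G [] = \<one>\<^bsub>G\<^esub>"
| "eval_word G ((x, b) # w) = (if b then x else inv\<^bsub>G\<^esub> x) \<otimes>\<^bsub>G\<^esub> eval_word G w"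

text \<open>Equality of words in the group with generators \<open>A\<close> and relators \<open>R\<close>, that is,
  in the free group on \<open>A\<close> modulo the normal closure of \<open>R\<close>.\<close>

inductive presented_eq :: "'g set \<Rightarrow> ('g \<times> bool) list set
    \<Rightarrow> ('g \<times> bool) list \<Rightarrow> ('g \<times> bool) list \<Rightarrow> bool"
  for A :: "'g set" and R :: "('g \<times> bool) list set" where
  refl: "presented_eq A R w w"
| sym: "presented_eq A R v w \<Longrightarrow> presented_eq A R w v"
| trans: "presented_eq A R u v \<Longrightarrow> presented_eq A R v w \<Longrightarrow> presented_eq A R u w"
| cancel: "x \<in> A \<Longrightarrow> presented_eq A R (v @ [(x, b), (x, \<not> b)] @ w) (v @ w)"
| relator: "r \<in> R \<Longrightarrow> presented_eq A R (v @ r @ w) (v @ w)"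

text \<open>\<open>G\<close> has presentation \<open>\<langle>A | R\<rangle>\<close>: the homomorphism from the free group on \<open>A\<close> to \<open>G\<close>
  is onto, and its kernel is the normal closure of \<open>R\<close>.\<close>

definition has_presentation ::
  "('g, 'm) monoid_scheme \<Rightarrow> 'g set \<Rightarrow> ('g \<times> bool) list set \<Rightarrow> bool" where
  "has_presentation G A R \<longleftrightarrow>
     group G \<and> A \<subseteq> carrier G \<and> generate G A = carrier G \<and>
     (\<forall>w \<in> lists (A \<times> UNIV). eval_word G w = \<one>\<^bsub>G\<^esub> \<longleftrightarrow> presented_eq A R w [])"

definition coxeter_relators :: "'w set \<Rightarrow> ('w \<Rightarrow> 'w \<Rightarrow> enat) \<Rightarrow> ('w \<times> bool) list set" where
  "coxeter_relators S n =
     {concat (replicate k [(r, True), (s, True)]) | r s k. r \<in> S \<and> s \<in> S \<and> n r s = enat k}"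

definition coxeter_system ::
  "('w, 'm) monoid_scheme \<Rightarrow> 'w set \<Rightarrow> ('w \<Rightarrow> 'w \<Rightarrow> enat) \<Rightarrow> bool" where
  "coxeter_system W S n \<longleftrightarrow>
     (\<forall>s\<in>S. n s s = 1) \<and>
     (\<forall>r\<in>S. \<forall>s\<in>S. r \<noteq> s \<longrightarrow> 1 < n r s \<and> n r s = n s r) \<and>
     has_presentation W S (coxeter_relators S n)"

definition cox_length :: "('w, 'm) monoid_scheme \<Rightarrow> 'w set \<Rightarrow> 'w \<Rightarrow> nat" where
  "cox_length W S w =
     (LEAST k. \<exists>ss \<in> lists S. length ss = k \<and> foldr (\<otimes>\<^bsub>W\<^esub>) ss \<one>\<^bsub>W\<^esub> = w)"

section \<open>Algebras over the field of rational functions\<close>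

type_synonym ratfun = "rat poly fract"

definition uu :: ratfun where
  "uu = Fract [:0, 1:] 1"

abbreviation Qu :: "ratfun ring" where
  "Qu \<equiv> ring_of_type_algebra"

text \<open>The locale \<open>algebra\<close> of HOL-Algebra requires a commutative multiplication, so it cannot
  be used here.\<close>

locale assoc_algebra = module R A + ring A
  for R :: "('r, 'm) ring_scheme" (structure) and A :: "('r, 'a, 'n) module_scheme" (structure) +
  assumes smult_mult_left:
      "\<lbrakk>a \<in> carrier R; x \<in> carrier A; y \<in> carrier A\<rbrakk> \<Longrightarrow>
        (a \<odot>\<^bsub>A\<^esub> x) \<otimes>\<^bsub>A\<^esub> y = a \<odot>\<^bsub>A\<^esub> (x \<otimes>\<^bsub>A\<^esub> y)"
    and smult_mult_right:
      "\<lbrakk>a \<in> carrier R; x \<in> carrier A; y \<in> carrier A\<rbrakk> \<Longrightarrow>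
        x \<otimes>\<^bsub>A\<^esub> (a \<odot>\<^bsub>A\<^esub> y) = a \<odot>\<^bsub>A\<^esub> (x \<otimes>\<^bsub>A\<^esub> y)"

definition algebra_hom ::
  "('r, 'm) ring_scheme \<Rightarrow> ('r, 'a, 'n) module_scheme \<Rightarrow> ('r, 'b, 'p) module_scheme
    \<Rightarrow> ('a \<Rightarrow> 'b) set" where
  "algebra_hom R A B =
     {f \<in> ring_hom A B. \<forall>a \<in> carrier R. \<forall>x \<in> carrier A. f (a \<odot>\<^bsub>A\<^esub> x) = a \<odot>\<^bsub>B\<^esub> f x}"

text \<open>The family \<open>(b i)\<close> with \<open>i \<in> I\<close> is a basis of \<open>M\<close>: every element of \<open>M\<close> is a finite linear
  combination in exactly one way.\<close>

definition is_basis ::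
  "('r, 'm) ring_scheme \<Rightarrow> ('r, 'a, 'n) module_scheme \<Rightarrow> 'i set \<Rightarrow> ('i \<Rightarrow> 'a) \<Rightarrow> bool" where
  "is_basis R M I b \<longleftrightarrow>
     b \<in> I \<rightarrow> carrier M \<and>
     (\<forall>x \<in> carrier M. \<exists>!c.
        range c \<subseteq> carrier R \<and> {i. c i \<noteq> \<zero>\<^bsub>R\<^esub>} \<subseteq> I \<and> finite {i. c i \<noteq> \<zero>\<^bsub>R\<^esub>} \<and>
        x = (\<Oplus>\<^bsub>M\<^esub>i \<in> {i. c i \<noteq> \<zero>\<^bsub>R\<^esub>}. c i \<odot>\<^bsub>M\<^esub> b i))"

text \<open>The algebra of all linear operators on \<open>M\<close>. An operator is given the value \<open>undefined\<close>
  outside \<open>carrier M\<close>, so that it is determined by its values on \<open>M\<close>.\<close>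

definition End_algebra ::
  "('r, 'm) ring_scheme \<Rightarrow> ('r, 'a, 'n) module_scheme \<Rightarrow> ('r, 'a \<Rightarrow> 'a) module" where
  "End_algebra R M =
     \<lparr>carrier = {f \<in> carrier M \<rightarrow>\<^sub>E carrier M.
        (\<forall>x \<in> carrier M. \<forall>y \<in> carrier M. f (x \<oplus>\<^bsub>M\<^esub> y) = f x \<oplus>\<^bsub>M\<^esub> f y) \<and>
        (\<forall>a \<in> carrier R. \<forall>x \<in> carrier M. f (a \<odot>\<^bsub>M\<^esub> x) = a \<odot>\<^bsub>M\<^esub> f x)},
      monoid.mult = (\<lambda>f g. \<lambda>x \<in> carrier M. f (g x)),
      monoid.one = (\<lambda>x \<in> carrier M. x),
      ring.zero = (\<lambda>x \<in> carrier M. \<zero>\<^bsub>M\<^esub>),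
      ring.add = (\<lambda>f g. \<lambda>x \<in> carrier M. f x \<oplus>\<^bsub>M\<^esub> g x),
      module.smult = (\<lambda>a f. \<lambda>x \<in> carrier M. a \<odot>\<^bsub>M\<^esub> f x)\<rparr>"

section \<open>The Hecke algebra\<close>

text \<open>The algebra is determined up to a unique isomorphism fixing the \<open>T w\<close>; \<open>H\<close> is any
  algebra of this kind, with its basis \<open>T\<close> as part of the data.\<close>

definition is_hecke_algebra ::
  "('w, 'm) monoid_scheme \<Rightarrow> 'w set \<Rightarrow> (ratfun, 'h, 'n) module_scheme \<Rightarrow> ('w \<Rightarrow> 'h) \<Rightarrow> bool" where
  "is_hecke_algebra W S H T \<longleftrightarrow>
     assoc_algebra Qu H \<and> is_basis Qu H (carrier W) T \<and>
     (\<forall>s \<in> S. \<forall>w \<in> carrier W.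
        (cox_length W S (s \<otimes>\<^bsub>W\<^esub> w) > cox_length W S w \<longrightarrow>
           T s \<otimes>\<^bsub>H\<^esub> T w = T (s \<otimes>\<^bsub>W\<^esub> w)) \<and>
        (cox_length W S (s \<otimes>\<^bsub>W\<^esub> w) < cox_length W S w \<longrightarrow>
           T s \<otimes>\<^bsub>H\<^esub> T w =
             (uu\<^sup>2 \<odot>\<^bsub>H\<^esub> T (s \<otimes>\<^bsub>W\<^esub> w)) \<oplus>\<^bsub>H\<^esub> ((uu\<^sup>2 - 1) \<odot>\<^bsub>H\<^esub> T w)))"

section \<open>Labeled digraphs\<close>

text \<open>Edges are abstract objects with tail and head, so multiple edges are allowed.
  An edge is dashed if it is not solid.\<close>

record ('v, 'e, 's) labeled_digraph =
  graph_of :: "('v, 'e) pre_digraph"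
  solid :: "'e \<Rightarrow> bool"
  label :: "'e \<Rightarrow> 's"

definition S_labeled_digraph :: "'s set \<Rightarrow> ('v, 'e, 's) labeled_digraph \<Rightarrow> bool" where
  "S_labeled_digraph S \<Gamma> \<longleftrightarrow>
     loopfree_digraph (graph_of \<Gamma>) \<and>
     (\<forall>e \<in> arcs (graph_of \<Gamma>). label \<Gamma> e \<in> S) \<and>
     (\<forall>s \<in> S. \<forall>v \<in> verts (graph_of \<Gamma>).
        \<exists>!e. e \<in> arcs (graph_of \<Gamma>) \<and> label \<Gamma> e = s \<and>
             (tail (graph_of \<Gamma>) e = v \<or> head (graph_of \<Gamma>) e = v))"

definition edge_at :: "('v, 'e, 's) labeled_digraph \<Rightarrow> 's \<Rightarrow> 'v \<Rightarrow> 'e" where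
  "edge_at \<Gamma> s \<alpha> =
     (THE e. e \<in> arcs (graph_of \<Gamma>) \<and> label \<Gamma> e = s \<and>
             (tail (graph_of \<Gamma>) e = \<alpha> \<or> head (graph_of \<Gamma>) e = \<alpha>))"

text \<open>The vector space with basis \<open>V\<close>, as finitely supported functions. The fields \<open>mult\<close> and
  \<open>one\<close> are present only because \<open>module\<close> extends \<open>ring\<close>.\<close>

definition free_space :: "'v set \<Rightarrow> (ratfun, 'v \<Rightarrow> ratfun) module" where
  "free_space V =
     \<lparr>carrier = {f. finite {v. f v \<noteq> 0} \<and> {v. f v \<noteq> 0} \<subseteq> V},
      monoid.mult = undefined,
      monoid.one = undefined,
      ring.zero = (\<lambda>v. 0),
      ring.add = (\<lambda>f g v. f v + g v),
      module.smult = (\<lambda>a f v. a * f v)\<rparr>"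

definition basis_vec :: "'v \<Rightarrow> 'v \<Rightarrow> ratfun" where
  "basis_vec \<alpha> = (\<lambda>\<beta>. if \<beta> = \<alpha> then 1 else 0)"

definition M_of :: "('v, 'e, 's) labeled_digraph \<Rightarrow> (ratfun, 'v \<Rightarrow> ratfun) module" where
  "M_of \<Gamma> = free_space (verts (graph_of \<Gamma>))"

definition tau_vertex :: "('v, 'e, 's) labeled_digraph \<Rightarrow> 's \<Rightarrow> 'v \<Rightarrow> 'v \<Rightarrow> ratfun" where
  "tau_vertex \<Gamma> s \<alpha> =
     (let e = edge_at \<Gamma> s \<alpha>; t = tail (graph_of \<Gamma>) e; h = head (graph_of \<Gamma>) e in
      if solid \<Gamma> e then
        (if t = \<alpha> then basis_vec h
         else (\<lambda>\<gamma>. (uu\<^sup>2 - 1) * basis_vec \<alpha> \<gamma> + uu\<^sup>2 * basis_vec t \<gamma>))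
      else
        (if t = \<alpha> then (\<lambda>\<gamma>. uu * basis_vec \<alpha> \<gamma> + (uu + 1) * basis_vec h \<gamma>)
         else (\<lambda>\<gamma>. (uu\<^sup>2 - uu - 1) * basis_vec \<alpha> \<gamma> + (uu\<^sup>2 - uu) * basis_vec t \<gamma>)))"

text \<open>The linear extension of \<open>tau_vertex\<close> to the whole space.\<close>

definition tau ::
  "('v, 'e, 's) labeled_digraph \<Rightarrow> 's \<Rightarrow> ('v \<Rightarrow> ratfun) \<Rightarrow> ('v \<Rightarrow> ratfun)" where
  "tau \<Gamma> s = (\<lambda>f \<in> carrier (M_of \<Gamma>). \<lambda>\<gamma>. \<Sum>\<alpha> | f \<alpha> \<noteq> 0. f \<alpha> * tau_vertex \<Gamma> s \<alpha> \<gamma>)"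

definition W_digraph ::
  "'w set \<Rightarrow> (ratfun, 'h, 'n) module_scheme \<Rightarrow> ('w \<Rightarrow> 'h) \<Rightarrow> ('v, 'e, 'w) labeled_digraph \<Rightarrow> bool" where
  "W_digraph S H T \<Gamma> \<longleftrightarrow>
     S_labeled_digraph S \<Gamma> \<and>
     (\<exists>\<rho> \<in> algebra_hom Qu H (End_algebra Qu (M_of \<Gamma>)). \<forall>s \<in> S. \<rho> (T s) = tau \<Gamma> s)"

section \<open>Sources, sinks, circuits and components\<close>

definition acyclic_digraph :: "('v, 'e) pre_digraph \<Rightarrow> bool" where
  "acyclic_digraph G \<longleftrightarrow> \<not> (\<exists>u p. pre_digraph.awalk G u p u \<and> p \<noteq> [])"

definition sources :: "('v, 'e) pre_digraph \<Rightarrow> 'v set" where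
  "sources G = {v \<in> verts G. in_arcs G v = {}}"

definition sinks :: "('v, 'e) pre_digraph \<Rightarrow> 'v set" where
  "sinks G = {v \<in> verts G. out_arcs G v = {}}"

text \<open>Maximal connected subgraphs; \<open>Digraph_Component.connected\<close> refers to the underlying
  undirected graph and excludes the empty graph.\<close>

definition components :: "('v, 'e) pre_digraph \<Rightarrow> ('v, 'e) pre_digraph set" where
  "components G =
     {C. subgraph C G \<and> Digraph_Component.connected C \<and>
         (\<forall>D. subgraph D G \<and> Digraph_Component.connected D \<and> subgraph C D \<longrightarrow> D = C)}"

end

theory Submission
  imports Defs
begin

text \<open>
  The idea is to specialise the representation at \<open>u = 0\<close>. There \<open>\<tau>\<^sub>s\<close> maps the tail \<open>\<alpha>\<close> of an edge
  \<open>\<alpha> \<rightarrow> \<beta>\<close> labeled \<open>s\<close>, solid or dashed, to \<open>\<beta>\<close>, and maps \<open>\<beta>\<close> to \<open>-\<beta>\<close>. So, up to sign,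
  \<open>\<tau>\<^sub>s\<close> becomes the idempotent map \<open>head_map s\<close> on vertices, which moves the tail of each edge labeled
  \<open>s\<close> to its head. For a reduced word of \<open>w\<close>, the product of the \<open>\<tau>\<^sub>s\<close> is the image of \<open>T w\<close>, hence
  depends only on \<open>w\<close>; comparing signed basis vectors, the same holds for the maps on vertices
  (\<open>head_words_eq\<close>). The vertices thus carry an action of the 0-Hecke monoid of \<open>(W, S)\<close>.

  In such an action a generator that shortens \<open>w\<close> fixes the image of \<open>w\<close>. Every edge of a directed
  walk moves a vertex, so the labels along a directed walk, read backwards, form a reduced word
  (\<open>walk_reduced_word\<close>). If \<open>W\<close> is finite, the lengths of reduced words are bounded, whereas a circuit
  could be traversed arbitrarily often: there are no circuits.

  An element \<open>w\<^sub>0\<close> of maximal length is shortened by every generator on either side. Therefore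
  \<open>w\<^sub>0\<close> maps each vertex to a vertex fixed by all generators, that is, to a sink of the same
  component, and it takes the same value at both ends of any edge. Sinks are fixed by \<open>w\<^sub>0\<close>, so each
  component contains exactly one (\<open>card_fixed_points\<close>).

  For sources, \<open>\<tau>\<^sub>s\<close> is replaced by its inverse. This is the operator of the reversed digraph with
  parameter \<open>-1/u\<close> in place of \<open>u\<close> (\<open>opr_rev_op\<close>), so the same argument applies with the
  specialisation at \<open>u = \<infinity>\<close>. To serve both cases, the operators are studied over an arbitrary field
  and reduced modulo a parameter \<open>z\<close> that is a non-unit in a subring.
\<close>

section \<open>Reduced words in groups generated by involutions\<close>

text \<open>The features of a Coxeter system on which the argument rests: \<open>W\<close> is generated by involutions,
  and the parity of a word depends only on its value, that is, \<open>W\<close> has a sign character. By parity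
  \<open>\<ell>(s w) \<noteq> \<ell>(w)\<close>, so that a generator either lengthens or shortens a given element.\<close>

locale sign_group = group W for W :: "('w, 'm) monoid_scheme" (structure) +
  fixes S :: "'w set"
  assumes gens_closed: "S \<subseteq> carrier W"
    and generated: "generate W S = carrier W"
    and involution: "s \<in> S \<Longrightarrow> s \<otimes> s = \<one>"
    and relations_even: "set ss \<subseteq> S \<Longrightarrow> foldr (\<otimes>) ss \<one> = \<one> \<Longrightarrow> even (length ss)"
begin

definition wprod :: "'w list \<Rightarrow> 'w" where
  "wprod ss = foldr (\<otimes>) ss \<one>"

lemma wprod_simps [simp]: "wprod [] = \<one>" "wprod (s # ss) = s \<otimes> wprod ss"
  by (simp_all add: wprod_def)

definition reduced :: "'w list \<Rightarrow> bool" where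
  "reduced ss \<longleftrightarrow> set ss \<subseteq> S \<and> length ss = cox_length W S (wprod ss)"

lemma gen_closed [simp]: "s \<in> S \<Longrightarrow> s \<in> carrier W"
  using gens_closed by auto

lemma wprod_closed [simp]: "set ss \<subseteq> S \<Longrightarrow> wprod ss \<in> carrier W"
  by (induction ss) auto

lemma wprod_append:
  "set ss \<subseteq> S \<Longrightarrow> set ts \<subseteq> S \<Longrightarrow> wprod (ss @ ts) = wprod ss \<otimes> wprod ts"
  by (induction ss) (auto simp: m_assoc)

lemma inv_gen [simp]: "s \<in> S \<Longrightarrow> inv s = s"
  by (intro inv_equality involution) auto

lemma wprod_rev: "set ss \<subseteq> S \<Longrightarrow> wprod (rev ss) = inv (wprod ss)"
  by (induction ss) (auto simp: wprod_append inv_mult_group)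

lemma gen_cancel [simp]: "s \<in> S \<Longrightarrow> w \<in> carrier W \<Longrightarrow> s \<otimes> (s \<otimes> w) = w"
  by (metis gen_closed involution l_one m_assoc)

lemma word_exists:
  assumes "w \<in> carrier W" obtains ss where "set ss \<subseteq> S" "wprod ss = w"
proof -
  have "w \<in> generate W S" using assms generated by simp
  then have "\<exists>ss. set ss \<subseteq> S \<and> wprod ss = w"
  proof induction
    case one
    show ?case by (rule exI[of _ "[]"]) auto
  next
    case (incl h)
    then show ?case by (intro exI[of _ "[h]"]) auto
  next
    case (inv h)
    then show ?case by (intro exI[of _ "[h]"]) auto
  next
    case (eng g h)
    then obtain ss ts where "set ss \<subseteq> S" "wprod ss = g" "set ts \<subseteq> S" "wprod ts = h" by blast
    then show ?case by (intro exI[of _ "ss @ ts"]) (auto simp: wprod_append)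
  qed
  then show ?thesis using that by blast
qed

lemma cox_length_le: "set ss \<subseteq> S \<Longrightarrow> cox_length W S (wprod ss) \<le> length ss"
  unfolding cox_length_def wprod_def by (rule Least_le) (auto intro!: exI[of _ ss])

lemma reduced_word_exists:
  assumes "w \<in> carrier W" obtains ss where "reduced ss" "wprod ss = w"
proof -
  obtain ts where "set ts \<subseteq> S" "wprod ts = w" using assms by (rule word_exists)
  then have "\<exists>ss. set ss \<subseteq> S \<and> length ss = cox_length W S w \<and> wprod ss = w"
    using LeastI_ex[of "\<lambda>k. \<exists>ss \<in> lists S. length ss = k \<and> foldr (\<otimes>) ss \<one> = w"]
    unfolding cox_length_def wprod_def by (auto simp: lists_eq_set)
  then show ?thesis using that unfolding reduced_def by blast
qed

lemma length_parity:
  assumes "set ss \<subseteq> S" "set ts \<subseteq> S" "wprod ss = wprod ts"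
  shows "even (length ss) \<longleftrightarrow> even (length ts)"
proof -
  have "wprod (ss @ rev ts) = \<one>" using assms by (simp add: wprod_append wprod_rev)
  then have "even (length (ss @ rev ts))" using assms by (intro relations_even) (auto simp: wprod_def)
  then show ?thesis by auto
qed

lemma reducedD [simp]: "reduced ss \<Longrightarrow> set ss \<subseteq> S"
  by (simp add: reduced_def)

lemma reduced_le: "reduced ss \<Longrightarrow> set ts \<subseteq> S \<Longrightarrow> wprod ts = wprod ss \<Longrightarrow> length ss \<le> length ts"
  using cox_length_le[of ts] by (simp add: reduced_def)

lemma reducedI:
  assumes "set ss \<subseteq> S" "\<And>ts. set ts \<subseteq> S \<Longrightarrow> wprod ts = wprod ss \<Longrightarrow> length ss \<le> length ts"
  shows "reduced ss"
proof -
  obtain ts where "reduced ts" "wprod ts = wprod ss" using reduced_word_exists[of "wprod ss"] assms by auto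
  then have "length ss \<le> cox_length W S (wprod ss)" using assms(2)[of ts] unfolding reduced_def by auto
  then show ?thesis using assms(1) cox_length_le[of ss] unfolding reduced_def by simp
qed

lemma reduced_Nil: "reduced []"
  by (rule reducedI) auto

lemma reduced_rev: assumes "reduced ss" shows "reduced (rev ss)"
proof (rule reducedI)
  fix ts assume "set ts \<subseteq> S" "wprod ts = wprod (rev ss)"
  then have "wprod (rev ts) = wprod ss" using assms by (simp add: wprod_rev)
  then have "length ss \<le> length (rev ts)"
    using \<open>set ts \<subseteq> S\<close> by (intro reduced_le[OF assms]) auto
  then show "length (rev ss) \<le> length ts" by simp
qed (use reducedD[OF assms] in auto)

lemma reduced_Cons_tail: assumes "reduced (s # ss)" shows "reduced ss"
proof (rule reducedI)
  show "set ss \<subseteq> S" using reducedD[OF assms] by simp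
  fix ts assume "set ts \<subseteq> S" "wprod ts = wprod ss"
  then have "length (s # ss) \<le> length (s # ts)"
    using reducedD[OF assms] by (intro reduced_le[OF assms]) auto
  then show "length ss \<le> length ts" by simp
qed

lemma reduced_Cons_length:
  assumes "reduced (s # ss)"
  shows "cox_length W S (wprod (s # ss)) > cox_length W S (wprod ss)"
  using assms reduced_Cons_tail[OF assms] unfolding reduced_def by simp

text \<open>If \<open>s\<close> does not lengthen \<open>w\<close>, then by parity it shortens it, so that a reduced word of \<open>s w\<close>
  preceded by \<open>s\<close> is a reduced word of \<open>w\<close>: every left descent of \<open>w\<close> begins some reduced word
  of \<open>w\<close>.\<close>

lemma left_descent_word:
  assumes ss: "reduced ss" and s: "s \<in> S" and nr: "\<not> reduced (s # ss)"
  obtains ts where "reduced (s # ts)" "wprod (s # ts) = wprod ss"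
proof -
  have sl: "set (s # ss) \<subseteq> S" using ss s by simp
  obtain ts where ts: "reduced ts" "wprod ts = wprod (s # ss)"
    using reduced_word_exists wprod_closed[OF sl] by metis
  have "length ts < Suc (length ss)"
    using nr sl ts cox_length_le[OF sl] unfolding reduced_def by force
  moreover have "even (length ts) \<longleftrightarrow> even (length (s # ss))"
    using ts sl by (intro length_parity) auto
  ultimately have lt: "Suc (length ts) \<le> length ss" by (cases "length ts = length ss") auto
  have stl: "set (s # ts) \<subseteq> S" using ts s by simp
  have eq: "wprod (s # ts) = wprod ss" using ts s ss by simp
  have "reduced (s # ts)"
  proof (rule reducedI)
    fix us assume "set us \<subseteq> S" "wprod us = wprod (s # ts)"
    then have "length ss \<le> length us" using reduced_le[OF ss] eq by metis
    then show "length (s # ts) \<le> length us" using lt by simp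
  qed (rule stl)
  then show ?thesis using eq by (rule that)
qed

lemma right_descent_word:
  assumes ss: "reduced ss" and s: "s \<in> S" and nr: "\<not> reduced (ss @ [s])"
  obtains ts where "reduced (ts @ [s])" "wprod (ts @ [s]) = wprod ss"
proof -
  have "\<not> reduced (s # rev ss)" using nr reduced_rev[of "s # rev ss"] by auto
  then obtain ts where ts: "reduced (s # ts)" "wprod (s # ts) = wprod (rev ss)"
    using left_descent_word reduced_rev[OF ss] s by blast
  have "reduced (rev ts @ [s])" using reduced_rev[OF ts(1)] by simp
  moreover have "wprod (rev ts @ [s]) = wprod ss"
  proof -
    have "wprod (rev (s # ts)) = wprod (rev (rev ss))"
      using ts(2) wprod_rev[OF reducedD[OF ts(1)]] wprod_rev[OF reducedD[OF reduced_rev[OF ss]]] by metis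
    then show ?thesis by simp
  qed
  ultimately show ?thesis by (rule that)
qed

end

text \<open>Free cancellation removes two letters; hence relators of even length preserve parity.\<close>

lemma presented_eq_length_parity:
  assumes "presented_eq A R v w" "\<And>r. r \<in> R \<Longrightarrow> even (length r)"
  shows "even (length v) \<longleftrightarrow> even (length w)"
  using assms by induction auto

lemma eval_word_positive:
  "eval_word G (map (\<lambda>s. (s, True)) ss) = foldr (\<otimes>\<^bsub>G\<^esub>) ss \<one>\<^bsub>G\<^esub>"
  by (induction ss) auto

lemma coxeter_system_sign_group:
  assumes "coxeter_system W S n" shows "sign_group W S"
proof -
  have hp: "has_presentation W S (coxeter_relators S n)" and n1: "\<And>s. s \<in> S \<Longrightarrow> n s s = 1"
    using assms unfolding coxeter_system_def by auto
  interpret group W using hp unfolding has_presentation_def by simp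
  have SW: "S \<subseteq> carrier W" and gen: "generate W S = carrier W"
    using hp unfolding has_presentation_def by auto
  have ker: "foldr (\<otimes>\<^bsub>W\<^esub>) ss \<one>\<^bsub>W\<^esub> = \<one>\<^bsub>W\<^esub> \<longleftrightarrow>
      presented_eq S (coxeter_relators S n) (map (\<lambda>s. (s, True)) ss) []" if "set ss \<subseteq> S" for ss
  proof -
    have "map (\<lambda>s. (s, True)) ss \<in> lists (S \<times> UNIV)" using that by (auto simp: in_lists_conv_set)
    then show ?thesis using hp unfolding has_presentation_def eval_word_positive[symmetric] by blast
  qed
  have ev: "even (length r)" if "r \<in> coxeter_relators S n" for r
    using that unfolding coxeter_relators_def by (auto simp: length_concat sum_list_replicate)
  show ?thesis
  proof
    show "S \<subseteq> carrier W" "generate W S = carrier W" by fact+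
  next
    fix s assume s: "s \<in> S"
    have "concat (replicate 1 [(s, True), (s, True)]) \<in> coxeter_relators S n"
      unfolding coxeter_relators_def mem_Collect_eq
      using s n1[OF s] by (intro exI conjI) (auto simp: one_enat_def)
    then have "[(s, True), (s, True)] \<in> coxeter_relators S n" by simp
    from presented_eq.relator[OF this, of S "[]" "[]"]
    have "presented_eq S (coxeter_relators S n) (map (\<lambda>s. (s, True)) [s, s]) []" by simp
    then have "foldr (\<otimes>\<^bsub>W\<^esub>) [s, s] \<one>\<^bsub>W\<^esub> = \<one>\<^bsub>W\<^esub>" by (subst ker) (use s in auto)
    then show "s \<otimes>\<^bsub>W\<^esub> s = \<one>\<^bsub>W\<^esub>" using s SW by auto
  next
    fix ss assume "set ss \<subseteq> S" "foldr (\<otimes>\<^bsub>W\<^esub>) ss \<one>\<^bsub>W\<^esub> = \<one>\<^bsub>W\<^esub>"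
    then have "presented_eq S (coxeter_relators S n) (map (\<lambda>s. (s, True)) ss) []" using ker by simp
    from presented_eq_length_parity[OF this ev] show "even (length ss)" by simp
  qed
qed

section \<open>Actions of the 0-Hecke monoid\<close>

text \<open>An action of the 0-Hecke monoid of \<open>(W, S)\<close>: the generators act by idempotents, and reduced words
  of the same element act in the same way. So each \<open>w\<close> acts through any of its reduced words, and
  multiplying \<open>w\<close> by a generator that shortens it has no effect. If \<open>W\<close> is finite, it has an
  element of maximal length, which absorbs every generator on either side.\<close>

locale zero_hecke_action = sign_group +
  fixes V :: "'v set" and act :: "'a \<Rightarrow> 'v \<Rightarrow> 'v"
  assumes act_closed [simp]: "s \<in> S \<Longrightarrow> v \<in> V \<Longrightarrow> act s v \<in> V"
    and act_idem: "s \<in> S \<Longrightarrow> v \<in> V \<Longrightarrow> act s (act s v) = act s v"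
    and act_reduced: "reduced ss \<Longrightarrow> reduced ts \<Longrightarrow> wprod ss = wprod ts \<Longrightarrow> v \<in> V \<Longrightarrow>
      foldr act ss v = foldr act ts v"
    and finite_group: "finite (carrier W)"
begin

lemma word_act_closed [simp]: "set ss \<subseteq> S \<Longrightarrow> v \<in> V \<Longrightarrow> foldr act ss v \<in> V"
  by (induction ss) auto

lemma left_descent_fixes:
  assumes "reduced ss" "s \<in> S" "\<not> reduced (s # ss)" "v \<in> V"
  shows "act s (foldr act ss v) = foldr act ss v"
proof -
  obtain ts where ts: "reduced (s # ts)" "wprod (s # ts) = wprod ss"
    using left_descent_word assms by blast
  have "foldr act ss v = foldr act (s # ts) v"
    using act_reduced[OF assms(1) ts(1)] ts(2) assms(4) by simp
  then show ?thesis using act_idem assms reducedD[OF ts(1)] by simp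
qed

lemma right_descent_absorbs:
  assumes "reduced ss" "s \<in> S" "\<not> reduced (ss @ [s])" "v \<in> V"
  shows "foldr act ss (act s v) = foldr act ss v"
proof -
  obtain ts where ts: "reduced (ts @ [s])" "wprod (ts @ [s]) = wprod ss"
    using right_descent_word assms by blast
  have eq: "foldr act ss v' = foldr act (ts @ [s]) v'" if "v' \<in> V" for v'
    using act_reduced[OF assms(1) ts(1) _ that] ts(2) by simp
  show ?thesis using eq[of v] eq[of "act s v"] act_idem assms by simp
qed

lemma longest_word_exists: "\<exists>ss. reduced ss \<and> (\<forall>ts. reduced ts \<longrightarrow> length ts \<le> length ss)"
proof -
  have fin: "finite (cox_length W S ` carrier W)" using finite_group by simp
  have "length ts < Suc (Max (cox_length W S ` carrier W))" if "reduced ts" for ts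
  proof -
    have "length ts = cox_length W S (wprod ts)" "wprod ts \<in> carrier W"
      using that reducedD[OF that] by (simp_all add: reduced_def)
    then show ?thesis using Max_ge[OF fin, of "length ts"] by simp
  qed
  then show ?thesis
    using ex_has_greatest_nat[of reduced "[]" length "Suc (Max (cox_length W S ` carrier W))"]
      reduced_Nil by blast
qed

definition longest :: "'a list" where
  "longest = (SOME ss. reduced ss \<and> (\<forall>ts. reduced ts \<longrightarrow> length ts \<le> length ss))"

lemma longest_reduced: "reduced longest"
  and longest_max: "reduced ts \<Longrightarrow> length ts \<le> length longest"
  using someI_ex[OF longest_word_exists] unfolding longest_def by auto

text \<open>The action of an element of maximal length. Since it absorbs generators on both sides, its
  values are fixed by all generators (\<open>act_final\<close>), and it does not distinguish the points of an
  orbit (\<open>final_act\<close>).\<close>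

definition final :: "'v \<Rightarrow> 'v" where
  "final v = foldr act longest v"

lemma act_final: "s \<in> S \<Longrightarrow> v \<in> V \<Longrightarrow> act s (final v) = final v"
  unfolding final_def using longest_max[of "s # longest"]
  by (intro left_descent_fixes longest_reduced) auto

lemma final_act: "s \<in> S \<Longrightarrow> v \<in> V \<Longrightarrow> final (act s v) = final v"
  unfolding final_def using longest_max[of "longest @ [s]"]
  by (intro right_descent_absorbs longest_reduced) auto

lemma final_fixed:
  assumes "\<And>s. s \<in> S \<Longrightarrow> act s v = v" shows "final v = v"
proof -
  have "foldr act ss v = v" if "set ss \<subseteq> S" for ss using that assms by (induction ss) auto
  then show ?thesis unfolding final_def using longest_reduced by simp
qed

lemma final_induct:
  assumes "v \<in> V" "P v" "\<And>s x. s \<in> S \<Longrightarrow> x \<in> V \<Longrightarrow> P x \<Longrightarrow> P (act s x)"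
  shows "P (final v)"
proof -
  have "P (foldr act ss v)" if "set ss \<subseteq> S" for ss
    using that assms by (induction ss) auto
  then show ?thesis unfolding final_def using longest_reduced by simp
qed

text \<open>Contrapositive of \<open>left_descent_fixes\<close>: a word every letter of which moves the point that it
  meets is reduced. In a finite group the length of such words is bounded.\<close>

lemma moving_word_reduced:
  assumes "reduced ss" "s \<in> S" "v \<in> V" "act s (foldr act ss v) \<noteq> foldr act ss v"
  shows "reduced (s # ss)"
  using left_descent_fixes assms by blast

end

section \<open>Specialising the operators of oriented matchings\<close>

text \<open>A subring \<open>R\<close> of a field in which \<open>z\<close> is not invertible, so that \<open>z R\<close> is a proper ideal of \<open>R\<close>
  and one can reduce modulo \<open>z\<close>, that is, specialise \<open>z\<close> to \<open>0\<close>.\<close>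

locale subring_nonunit =
  fixes R :: "'k::field set" and z :: 'k
  assumes one_mem [simp]: "1 \<in> R"
    and add_mem [simp]: "a \<in> R \<Longrightarrow> b \<in> R \<Longrightarrow> a + b \<in> R"
    and minus_mem [simp]: "a \<in> R \<Longrightarrow> - a \<in> R"
    and mult_mem [simp]: "a \<in> R \<Longrightarrow> b \<in> R \<Longrightarrow> a * b \<in> R"
    and z_mem [simp]: "z \<in> R"
    and z_nonzero: "z \<noteq> 0"
    and z_nonunit: "inverse z \<notin> R"
begin

lemma diff_mem [simp]: "a \<in> R \<Longrightarrow> b \<in> R \<Longrightarrow> a - b \<in> R"
  using add_mem[of a "- b"] by simp

lemma zero_mem [simp]: "0 \<in> R"
  using diff_mem[of 1 1] by simp

text \<open>Congruence modulo \<open>z\<close> to \<open>\<epsilon>\<close> times the basis vector of \<open>\<alpha>\<close>. If \<open>\<epsilon>\<close> lies in \<open>R\<close>, this puts all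
  coordinates of \<open>f\<close> into \<open>R\<close>.\<close>

definition reduces_to :: "('v \<Rightarrow> 'k) \<Rightarrow> 'k \<Rightarrow> 'v \<Rightarrow> bool" where
  "reduces_to f \<epsilon> \<alpha> \<longleftrightarrow> (\<forall>\<gamma>. \<exists>r\<in>R. f \<gamma> = (if \<gamma> = \<alpha> then \<epsilon> else 0) + z * r)"

lemma reduces_to_unique:
  assumes "reduces_to f \<epsilon> \<alpha>" "reduces_to f \<delta> \<beta>" "\<epsilon> \<in> {1, -1}"
  shows "\<alpha> = \<beta>"
proof (rule ccontr)
  assume ne: "\<alpha> \<noteq> \<beta>"
  obtain r where r: "r \<in> R" "f \<alpha> = \<epsilon> + z * r"
    using assms(1) unfolding reduces_to_def by (metis (full_types))
  obtain r' where r': "r' \<in> R" "f \<alpha> = z * r'"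
    using assms(2) ne unfolding reduces_to_def by (metis (full_types) add_0)
  have eq: "\<epsilon> = z * (r' - r)" using r r' by (simp add: algebra_simps)
  then have "inverse z = \<epsilon> * (r' - r)"
    using assms(3) z_nonzero by (auto simp: field_simps)
  moreover have "\<epsilon> * (r' - r) \<in> R" using assms(3) r r' by auto
  ultimately show False using z_nonunit by simp
qed

end

text \<open>The operator \<open>\<tau>\<^sub>s\<close> written in coordinates, with a free parameter \<open>z\<close> in place of \<open>u\<close>. The
  labeled digraph enters only through three functions of a label and a vertex: the other endpoint of
  the edge, whether the vertex is its tail, and whether it is solid. Thus reversing all edges amounts
  to negating \<open>out\<close>, and both orientations are treated by the same lemmas.\<close>

definition matching_op :: "'v set \<Rightarrow> ('s \<Rightarrow> 'v \<Rightarrow> 'v) \<Rightarrow> ('s \<Rightarrow> 'v \<Rightarrow> bool) \<Rightarrow> ('s \<Rightarrow> 'v \<Rightarrow> bool)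
    \<Rightarrow> 'k::field \<Rightarrow> 's \<Rightarrow> ('v \<Rightarrow> 'k) \<Rightarrow> 'v \<Rightarrow> 'k" where
  "matching_op V p out sol z s f \<gamma> =
     (if \<gamma> \<notin> V then 0
      else if sol s \<gamma> then
        (if out s \<gamma> then z\<^sup>2 * f (p s \<gamma>) else (z\<^sup>2 - 1) * f \<gamma> + f (p s \<gamma>))
      else
        (if out s \<gamma> then z * f \<gamma> + (z\<^sup>2 - z) * f (p s \<gamma>)
         else (z\<^sup>2 - z - 1) * f \<gamma> + (z + 1) * f (p s \<gamma>)))"

locale oriented_matchings =
  fixes S :: "'s set" and V :: "'v set" and p :: "'s \<Rightarrow> 'v \<Rightarrow> 'v"
    and out sol :: "'s \<Rightarrow> 'v \<Rightarrow> bool"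
  assumes partner_closed [simp]: "s \<in> S \<Longrightarrow> v \<in> V \<Longrightarrow> p s v \<in> V"
    and partner_partner [simp]: "s \<in> S \<Longrightarrow> v \<in> V \<Longrightarrow> p s (p s v) = v"
    and out_partner [simp]: "s \<in> S \<Longrightarrow> v \<in> V \<Longrightarrow> out s (p s v) \<longleftrightarrow> \<not> out s v"
    and sol_partner [simp]: "s \<in> S \<Longrightarrow> v \<in> V \<Longrightarrow> sol s (p s v) \<longleftrightarrow> sol s v"
begin

abbreviation opr :: "'k::field \<Rightarrow> 's \<Rightarrow> ('v \<Rightarrow> 'k) \<Rightarrow> 'v \<Rightarrow> 'k" where
  "opr \<equiv> matching_op V p out sol"

abbreviation rev_op :: "'k::field \<Rightarrow> 's \<Rightarrow> ('v \<Rightarrow> 'k) \<Rightarrow> 'v \<Rightarrow> 'k" where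
  "rev_op \<equiv> matching_op V p (\<lambda>s v. \<not> out s v) sol"

text \<open>Reduced modulo \<open>z\<close>, the operator of \<open>s\<close> sends a tail of an edge labeled \<open>s\<close> to its head, and a head
  to its negative. Up to sign, it is this map on vertices.\<close>

definition head_map :: "'s \<Rightarrow> 'v \<Rightarrow> 'v" where
  "head_map s v = (if out s v then p s v else v)"

lemma head_map_closed [simp]: "s \<in> S \<Longrightarrow> v \<in> V \<Longrightarrow> head_map s v \<in> V"
  by (simp add: head_map_def)

lemma reversed: "oriented_matchings S V p (\<lambda>s v. \<not> out s v) sol"
  by unfold_locales auto

text \<open>The bar involution at the level of digraphs: the inverse of the operator with parameter \<open>z\<close> is the
  operator of the reversed digraph with parameter \<open>-1/z\<close>. It is the reason why sources behave like
  sinks. The sign of \<open>-1/z\<close> is forced by the dashed edges; the solid ones involve only \<open>z\<^sup>2\<close>.\<close>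

lemma opr_rev_op:
  fixes z :: "'k::field"
  assumes z: "z \<noteq> 0" and s: "s \<in> S" and f: "\<And>v. v \<notin> V \<Longrightarrow> f v = 0"
  shows "opr z s (rev_op (- inverse z) s f) = f"
    and "rev_op (- inverse z) s (opr z s f) = f"
proof -
  show "opr z s (rev_op (- inverse z) s f) = f"
  proof
    fix v show "opr z s (rev_op (- inverse z) s f) v = f v"
      using z s f[of v] by (auto simp: matching_op_def field_simps power2_eq_square)
  qed
  show "rev_op (- inverse z) s (opr z s f) = f"
  proof
    fix v show "rev_op (- inverse z) s (opr z s f) v = f v"
      using z s f[of v] by (auto simp: matching_op_def field_simps power2_eq_square)
  qed
qed

lemma finite_support_matching_op:
  assumes s: "s \<in> S" and f: "finite {v. f v \<noteq> 0}" "{v. f v \<noteq> 0} \<subseteq> V"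
  shows "finite {v. opr z s f v \<noteq> 0}" "{v. opr z s f v \<noteq> 0} \<subseteq> V"
proof -
  show V: "{v. opr z s f v \<noteq> 0} \<subseteq> V" by (auto simp: matching_op_def)
  have "{v. opr z s f v \<noteq> 0} \<subseteq> {v. f v \<noteq> 0} \<union> p s ` {v. f v \<noteq> 0}"
  proof
    fix v assume v: "v \<in> {v. opr z s f v \<noteq> 0}"
    then have "v \<in> V" using V by auto
    have "f v \<noteq> 0 \<or> f (p s v) \<noteq> 0"
      using v by (auto simp: matching_op_def split: if_splits)
    moreover have "v = p s (p s v)" using s \<open>v \<in> V\<close> by simp
    ultimately show "v \<in> {v. f v \<noteq> 0} \<union> p s ` {v. f v \<noteq> 0}" by blast
  qed
  then show "finite {v. opr z s f v \<noteq> 0}" using f by (meson finite_UnI finite_imageI finite_subset)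
qed

end

locale reduced_matchings = oriented_matchings + subring_nonunit
begin

text \<open>Modulo \<open>z\<close> the coefficients of the solid and of the dashed edges agree.\<close>

lemma opr_mod_z:
  assumes s: "s \<in> S" and v: "v \<in> V" and f: "f v \<in> R" "f (p s v) \<in> R"
  shows "\<exists>q\<in>R. opr z s f v = (if out s v then 0 else f (p s v) - f v) + z * q"
proof -
  consider "sol s v" "out s v" | "sol s v" "\<not> out s v" | "\<not> sol s v" "out s v" | "\<not> sol s v" "\<not> out s v"
    by blast
  then show ?thesis
  proof cases
    case 1
    then show ?thesis using v f
      by (intro bexI[of _ "z * f (p s v)"]) (auto simp: matching_op_def power2_eq_square algebra_simps)
  next
    case 2
    then show ?thesis using v f
      by (intro bexI[of _ "z * f v"]) (auto simp: matching_op_def power2_eq_square algebra_simps)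
  next
    case 3
    then show ?thesis using v f
      by (intro bexI[of _ "f v + (z - 1) * f (p s v)"])
        (auto simp: matching_op_def power2_eq_square algebra_simps)
  next
    case 4
    then show ?thesis using v f
      by (intro bexI[of _ "(z - 1) * f v + f (p s v)"])
        (auto simp: matching_op_def power2_eq_square algebra_simps)
  qed
qed

text \<open>One step of the specialisation: basis vectors go to signed basis vectors. The sign records whether
  the vertex has been moved.\<close>

lemma opr_reduces_to:
  assumes s: "s \<in> S" and \<alpha>: "\<alpha> \<in> V" and \<epsilon>: "\<epsilon> \<in> {1, -1}" and f: "reduces_to f \<epsilon> \<alpha>"
  shows "reduces_to (opr z s f) (if out s \<alpha> then \<epsilon> else - \<epsilon>) (head_map s \<alpha>)"
  unfolding reduces_to_def
proof
  fix v
  let ?\<delta> = "\<lambda>v. if v = \<alpha> then \<epsilon> else 0"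
  let ?t = "if v = head_map s \<alpha> then if out s \<alpha> then \<epsilon> else - \<epsilon> else 0"
  show "\<exists>r\<in>R. opr z s f v = ?t + z * r"
  proof (cases "v \<in> V")
    case False
    then show ?thesis using head_map_closed[OF s \<alpha>]
      by (intro bexI[of _ 0]) (auto simp: matching_op_def)
  next
    case v: True
    have eR: "?\<delta> w \<in> R" for w using \<epsilon> by auto
    obtain a where a: "a \<in> R" "f v = ?\<delta> v + z * a" using f unfolding reduces_to_def by blast
    obtain b where b: "b \<in> R" "f (p s v) = ?\<delta> (p s v) + z * b" using f unfolding reduces_to_def by blast
    have "f v \<in> R" "f (p s v) \<in> R" unfolding a(2) b(2) using a(1) b(1) eR by auto
    then obtain q where q: "q \<in> R" "opr z s f v = (if out s v then 0 else f (p s v) - f v) + z * q"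
      using opr_mod_z[OF s v] by blast
    have t: "?t = (if out s v then 0 else ?\<delta> (p s v) - ?\<delta> v)"
    proof -
      have "p s v = \<alpha> \<longleftrightarrow> v = p s \<alpha>" using s v \<alpha> by auto
      moreover have "out s (p s \<alpha>) \<longleftrightarrow> \<not> out s \<alpha>" "\<alpha> \<noteq> p s \<alpha>"
        using out_partner[OF s \<alpha>] by metis+
      ultimately show ?thesis by (auto simp: head_map_def)
    qed
    show ?thesis
    proof (cases "out s v")
      case True
      then show ?thesis using q t by (intro bexI[of _ q]) auto
    next
      case False
      then have "opr z s f v = ?t + z * (b - a + q)"
        unfolding t q(2) a(2) b(2) by (simp add: algebra_simps)
      then show ?thesis using a b q by (intro bexI[of _ "b - a + q"]) auto
    qed
  qed
qed

lemma word_reduces_to: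
  assumes ss: "set ss \<subseteq> S" and \<alpha>: "\<alpha> \<in> V" and f: "reduces_to f 1 \<alpha>"
  shows "\<exists>\<epsilon>\<in>{1, -1}. reduces_to (foldr (opr z) ss f) \<epsilon> (foldr head_map ss \<alpha>)"
  using ss
proof (induction ss)
  case Nil
  then show ?case using f by auto
next
  case (Cons s ss)
  have "foldr head_map ts \<alpha> \<in> V" if "set ts \<subseteq> S" for ts using that \<alpha> by (induction ts) auto
  then have V: "foldr head_map ss \<alpha> \<in> V" using Cons.prems by simp
  obtain \<epsilon> where e: "\<epsilon> \<in> {1, -1}" "reduces_to (foldr (opr z) ss f) \<epsilon> (foldr head_map ss \<alpha>)"
    using Cons by auto
  have s: "s \<in> S" using Cons.prems by simp
  show ?case
    using opr_reduces_to[OF s V e] e(1)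
    by (intro bexI[of _ "if out s (foldr head_map ss \<alpha>) then \<epsilon> else - \<epsilon>"]) auto
qed

text \<open>A signed basis vector determines its vertex because \<open>1\<close> is not a multiple of \<open>z\<close> in \<open>R\<close>. Hence an
  equality of products of operators, tested on basis vectors, descends to the vertex maps.\<close>

lemma head_words_eq:
  assumes "set ss \<subseteq> S" "set ts \<subseteq> S" "\<alpha> \<in> V"
    and "foldr (opr z) ss (\<lambda>\<beta>. if \<beta> = \<alpha> then 1 else 0) = foldr (opr z) ts (\<lambda>\<beta>. if \<beta> = \<alpha> then 1 else 0)"
  shows "foldr head_map ss \<alpha> = foldr head_map ts \<alpha>"
proof -
  have "reduces_to (\<lambda>\<beta>. if \<beta> = \<alpha> then 1 else 0) 1 \<alpha>"
    unfolding reduces_to_def by (intro allI bexI[of _ 0]) auto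
  from word_reduces_to[OF assms(1,3) this] word_reduces_to[OF assms(2,3) this]
  show ?thesis using assms(4) reduces_to_unique by metis
qed

end

section \<open>Rational functions at zero and at infinity\<close>

lemma uu_nonzero: "uu \<noteq> 0"
  unfolding uu_def Zero_fract_def by (simp add: eq_fract)

lemma inverse_uu: "inverse uu = Fract 1 [:0, 1:]"
  unfolding uu_def by simp

text \<open>For the specialisation \<open>u = 0\<close>; the subring consists of the polynomials in \<open>u\<close>.\<close>

lemma subring_at_zero: "subring_nonunit (range (\<lambda>p. Fract p 1)) uu"
proof
  show "inverse uu \<notin> range (\<lambda>p. Fract p 1)"
  proof
    assume "inverse uu \<in> range (\<lambda>p. Fract p 1)"
    then obtain p :: "rat poly" where "Fract 1 [:0, 1:] = Fract p 1" unfolding inverse_uu by auto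
    then have "1 = p * [:0, 1:]" by (simp add: eq_fract)
    then have "poly 1 0 = poly (p * [:0, 1:]) 0" by metis
    then show False by simp
  qed
qed (use uu_nonzero in \<open>auto simp: One_fract_def uu_def\<close>)

text \<open>For the specialisation \<open>-1/u = 0\<close>, that is, \<open>u = \<infinity>\<close>: the degrees show that \<open>u\<close> does not belong to
  this subring, so \<open>-1/u\<close> is a non-unit in it.\<close>

definition regular_at_infinity :: "ratfun set" where
  "regular_at_infinity = {Fract p q | p q. q \<noteq> 0 \<and> degree p \<le> degree q}"

lemma subring_at_infinity: "subring_nonunit regular_at_infinity (- inverse uu)"
proof
  show "1 \<in> regular_at_infinity"
    unfolding regular_at_infinity_def One_fract_def by force
  show "- inverse uu \<in> regular_at_infinity"
    unfolding regular_at_infinity_def inverse_uu minus_fract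
    by (intro CollectI exI[of _ "-1"] exI[of _ "[:0, 1:]"]) auto
  show "- inverse uu \<noteq> 0" using uu_nonzero by simp
  fix a b assume a: "a \<in> regular_at_infinity"
  then obtain p q where p: "a = Fract p q" "q \<noteq> 0" "degree p \<le> degree q"
    unfolding regular_at_infinity_def by blast
  show "- a \<in> regular_at_infinity" 
    unfolding regular_at_infinity_def p minus_fract using p
    by (intro CollectI exI[of _ "-p"] exI[of _ q]) auto
  assume b: "b \<in> regular_at_infinity"
  then obtain p' q' where p': "b = Fract p' q'" "q' \<noteq> 0" "degree p' \<le> degree q'"
    unfolding regular_at_infinity_def by blast
  have qq: "degree (q * q') = degree q + degree q'" using p p' by (intro degree_mult_eq)
  have d: "degree (p * q') \<le> degree (q * q')" "degree (p' * q) \<le> degree (q * q')"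
    "degree (p * p') \<le> degree (q * q')"
    using degree_mult_le[of p q'] degree_mult_le[of p' q] degree_mult_le[of p p'] p p' qq by linarith+
  show "a + b \<in> regular_at_infinity"
    unfolding regular_at_infinity_def p p' add_fract[OF p(2) p'(2)] using p p' d degree_add_le
    by (intro CollectI exI[of _ "p * q' + p' * q"] exI[of _ "q * q'"]) auto
  show "a * b \<in> regular_at_infinity"
    unfolding regular_at_infinity_def p p' mult_fract using p p' d
    by (intro CollectI exI[of _ "p * p'"] exI[of _ "q * q'"]) auto
next
  show "inverse (- inverse uu) \<notin> regular_at_infinity"
  proof
    assume "inverse (- inverse uu) \<in> regular_at_infinity"
    then obtain p q :: "rat poly" where pq: "- Fract [:0, 1:] 1 = Fract p q" "q \<noteq> 0" "degree p \<le> degree q"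
      unfolding regular_at_infinity_def uu_def[symmetric] by auto
    then have "- [:0, 1:] * q = p" by (simp add: eq_fract)
    moreover have "degree (- [:0, 1:] * q) = 1 + degree q"
      using pq by (subst degree_mult_eq) auto
    ultimately show False using pq(3) by simp
  qed
qed

section \<open>Counting components by a retraction\<close>

text \<open>If \<open>r\<close> is constant along edges and joins each vertex to a fixed point of \<open>r\<close>, then the fixed points
  represent the components: the component of a fixed point \<open>x\<close> is induced on the fibre of \<open>x\<close>.\<close>

lemma card_components_retraction:
  fixes G :: "('v, 'e) pre_digraph" and r :: "'v \<Rightarrow> 'v"
  assumes wf: "wf_digraph G"
    and arc: "\<And>e. e \<in> arcs G \<Longrightarrow> r (tail G e) = r (head G e)"
    and reach: "\<And>v. v \<in> verts G \<Longrightarrow> reachable (with_proj (mk_symmetric G)) v (r v)"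
    and fixed: "\<And>v. v \<in> verts G \<Longrightarrow> r (r v) = r v"
  shows "card (components G) = card {v \<in> verts G. r v = v}"
proof -
  interpret wf_digraph G by fact
  define F where "F x = {v \<in> verts G. r v = x}" for x
  define C where "C x = G \<restriction> F x" for x
  \<comment> \<open>stated for subgraphs, because maximality of a component is tested against all of them\<close>
  have const: "r u = r v" if "reachable (with_proj (mk_symmetric H)) u v" "subgraph H G" for H u v
    using reachable_rtranclI[OF that(1)]
  proof (induction rule: converse_rtrancl_induct)
    case base
    then show ?case by simp
  next
    case (step u w)
    then have "\<exists>e \<in> arcs H. (u, w) = (tail H e, head H e) \<or> (u, w) = (head H e, tail H e)"
      by (auto simp: parcs_mk_symmetric)
    then have "\<exists>e \<in> arcs G. (u, w) = (tail G e, head G e) \<or> (u, w) = (head G e, tail G e)"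
      using that(2) by (auto simp: subgraph_def compatible_def)
    then have "r u = r w" using arc by auto
    then show ?case using step.IH by simp
  qed
  have sub_refl: "subgraph G G" by (rule subgraph_refl)
  have sub: "subgraph (C x) G" for x
    unfolding C_def F_def by (intro subgraph_induce_subgraphI) auto
  interpret MG: pair_wf_digraph "mk_symmetric G" by (rule wellformed_mk_symmetric)
  \<comment> \<open>an undirected path never leaves the fibre of its end\<close>
  have inside: "reachable (with_proj (mk_symmetric (C (r v)))) u v"
    if "reachable (with_proj (mk_symmetric G)) u v" for u v
    using that
  proof (induction rule: MG.converse_reachable_induct)
    case base
    then show ?case by (auto simp: C_def F_def reachable_def)
  next
    case (step u w)
    have rw: "r w = r v" using const[OF _ sub_refl] step.hyps(2) by simp
    obtain e where e: "e \<in> arcs G" "(u, w) = (tail G e, head G e) \<or> (u, w) = (head G e, tail G e)"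
      using step.hyps(1) by (auto simp: parcs_mk_symmetric)
    then have ru: "r u = r v" using arc rw by auto
    have "u \<in> verts G" "w \<in> verts G" using e by auto
    then have "e \<in> arcs (C (r v))" using e ru rw by (auto simp: C_def F_def)
    then have adj: "(u, w) \<in> parcs (mk_symmetric (C (r v)))"
      using e by (auto simp: parcs_mk_symmetric C_def)
    interpret M: pair_wf_digraph "mk_symmetric (C (r v))"
      using sub by (auto simp: subgraph_def intro: wf_digraph.wellformed_mk_symmetric)
    show ?case using M.adj_reachable_trans[of u w v] adj step.IH by simp
  qed
  have rv: "r v \<in> verts G" if "v \<in> verts G" for v
    using reach[OF that] by (auto elim: reachable_in_vertsE)
  have conn: "Digraph_Component.connected (C x)" if x: "x \<in> verts G" "r x = x" for x
    unfolding connected_def strongly_connected_def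
  proof (intro conjI ballI)
    show "verts (with_proj (mk_symmetric (C x))) \<noteq> {}" using x by (auto simp: C_def F_def)
    interpret M: pair_wf_digraph "mk_symmetric (C x)"
      using sub by (auto simp: subgraph_def intro: wf_digraph.wellformed_mk_symmetric)
    have to: "reachable (with_proj (mk_symmetric (C x))) u x" if "u \<in> F x" for u
    proof -
      have "r u = x" "u \<in> verts G" using that unfolding F_def by auto
      then show ?thesis using inside[OF reach[of u]] x by simp
    qed
    fix u v assume "u \<in> verts (with_proj (mk_symmetric (C x)))" "v \<in> verts (with_proj (mk_symmetric (C x)))"
    then have "u \<in> F x" "v \<in> F x" by (auto simp: C_def)
    then show "reachable (with_proj (mk_symmetric (C x))) u v"
      using to symmetric_reachable[OF symmetric_mk_symmetric to] M.reachable_trans by blast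
  qed
  have inC: "subgraph D (C (r v))"
    if D: "subgraph D G" "Digraph_Component.connected D" and v: "v \<in> verts D" for D v
  proof -
    have "verts D \<subseteq> F (r v)"
    proof
      fix u assume "u \<in> verts D"
      then have "reachable (with_proj (mk_symmetric D)) u v"
        using D(2) v by (auto simp: connected_def strongly_connected_def)
      then show "u \<in> F (r v)" using const D(1) \<open>u \<in> verts D\<close> by (auto simp: F_def subgraph_def)
    qed
    then show ?thesis
      using D(1) sub[of "r v"] wf_digraph.wellformed[of D]
      by (auto simp: subgraph_def compatible_def C_def)
  qed
  have antisym: "H = K" if "subgraph H K" "subgraph K H" for H K :: "('v, 'e) pre_digraph"
    using that by (auto simp: subgraph_def compatible_def intro: pre_digraph.equality)
  have "components G = C ` {v \<in> verts G. r v = v}"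
  proof (intro equalityI subsetI)
    fix D assume "D \<in> components G"
    then have D: "subgraph D G" "Digraph_Component.connected D"
      and mx: "\<And>K. subgraph K G \<Longrightarrow> Digraph_Component.connected K \<Longrightarrow> subgraph D K \<Longrightarrow> K = D"
      unfolding components_def by auto
    obtain v where v: "v \<in> verts D" using D(2) by (auto simp: connected_def strongly_connected_def)
    then have vG: "v \<in> verts G" using D(1) by (auto simp: subgraph_def)
    have "C (r v) = D" using mx[OF sub conn[OF rv[OF vG] fixed[OF vG]] inC[OF D v]] .
    then show "D \<in> C ` {v \<in> verts G. r v = v}" using rv[OF vG] fixed[OF vG] by blast
  next
    fix D assume "D \<in> C ` {v \<in> verts G. r v = v}"
    then obtain x where x: "x \<in> verts G" "r x = x" "D = C x" by auto
    have "K = C x" if K: "subgraph K G" "Digraph_Component.connected K" "subgraph (C x) K" for K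
    proof -
      have "x \<in> verts K" using K(3) x by (auto simp: subgraph_def C_def F_def)
      then show ?thesis using antisym[OF _ K(3)] inC[OF K(1,2)] x by metis
    qed
    then show "D \<in> components G" unfolding components_def using x sub conn by auto
  qed
  moreover have "inj_on C {v \<in> verts G. r v = v}"
  proof (rule inj_onI)
    fix x y assume xy: "x \<in> {v \<in> verts G. r v = v}" "y \<in> {v \<in> verts G. r v = v}" "C x = C y"
    then have "F x = F y" by (metis C_def induce_subgraph_verts)
    then show "x = y" using xy unfolding F_def by auto
  qed
  ultimately show ?thesis by (simp add: card_image)
qed

text \<open>For a 0-Hecke action along the edges of a digraph, the action of an element of maximal length is
  such a retraction, and its fixed points are the points fixed by all generators.\<close>

lemma (in zero_hecke_action) card_fixed_points:
  fixes G :: "('v, 'e) pre_digraph"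
  assumes wf: "wf_digraph G" and verts: "verts G = V"
    and arc: "\<And>e. e \<in> arcs G \<Longrightarrow>
      \<exists>s\<in>S. act s (tail G e) = head G e \<or> act s (head G e) = tail G e"
    and conn: "\<And>s v. s \<in> S \<Longrightarrow> v \<in> V \<Longrightarrow>
      reachable (with_proj (mk_symmetric G)) v (act s v)"
  shows "card {v \<in> V. \<forall>s\<in>S. act s v = v} = card (components G)"
proof -
  interpret wf_digraph G by (rule wf)
  interpret M: pair_wf_digraph "mk_symmetric G" by (rule wellformed_mk_symmetric)
  have fixed: "final v = v \<longleftrightarrow> (\<forall>s\<in>S. act s v = v)" if "v \<in> V" for v
    using act_final[OF _ that] final_fixed[of v] by auto
  have "card (components G) = card {v \<in> verts G. final v = v}"
  proof (rule card_components_retraction[OF wf])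
    fix e assume e: "e \<in> arcs G"
    then have "tail G e \<in> V" "head G e \<in> V" using verts by auto
    then show "final (tail G e) = final (head G e)" using arc[OF e] final_act by metis
  next
    fix v assume "v \<in> verts G"
    then have v: "v \<in> V" using verts by simp
    show "final (final v) = final v"
      by (rule final_fixed) (rule act_final[OF _ v])
    have "final v \<in> V \<and> reachable (with_proj (mk_symmetric G)) v (final v)"
    proof (rule final_induct[OF v])
      show "v \<in> V \<and> reachable (with_proj (mk_symmetric G)) v v"
        using v verts by simp
    next
      fix s x assume sx: "s \<in> S" "x \<in> V"
        and IH: "x \<in> V \<and> reachable (with_proj (mk_symmetric G)) v x"
      show "act s x \<in> V \<and> reachable (with_proj (mk_symmetric G)) v (act s x)"
        using M.reachable_trans[OF _ conn[OF sx]] IH act_closed[OF sx] by simp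
    qed
    then show "reachable (with_proj (mk_symmetric G)) v (final v)" ..
  qed
  also have "{v \<in> verts G. final v = v} = {v \<in> V. \<forall>s\<in>S. act s v = v}"
    using fixed verts by auto
  finally show ?thesis ..
qed

section \<open>The operators of a labeled digraph in coordinates\<close>

locale labeled =
  fixes S :: "'s set" and \<Gamma> :: "('v, 'e, 's) labeled_digraph"
  assumes lab: "S_labeled_digraph S \<Gamma>"
begin

abbreviation "G \<equiv> graph_of \<Gamma>"
abbreviation "V \<equiv> verts G"

sublocale loopfree_digraph G
  using lab unfolding S_labeled_digraph_def by simp

definition partner :: "'s \<Rightarrow> 'v \<Rightarrow> 'v" where
  "partner s v = (if tail G (edge_at \<Gamma> s v) = v then head G (edge_at \<Gamma> s v) else tail G (edge_at \<Gamma> s v))"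

definition out :: "'s \<Rightarrow> 'v \<Rightarrow> bool" where
  "out s v \<longleftrightarrow> tail G (edge_at \<Gamma> s v) = v"

definition solid_at :: "'s \<Rightarrow> 'v \<Rightarrow> bool" where
  "solid_at s v \<longleftrightarrow> solid \<Gamma> (edge_at \<Gamma> s v)"

lemma edge_at:
  assumes "s \<in> S" "v \<in> V"
  shows "edge_at \<Gamma> s v \<in> arcs G" "label \<Gamma> (edge_at \<Gamma> s v) = s"
    "tail G (edge_at \<Gamma> s v) = v \<or> head G (edge_at \<Gamma> s v) = v"
proof -
  have "\<exists>!e. e \<in> arcs G \<and> label \<Gamma> e = s \<and> (tail G e = v \<or> head G e = v)"
    using lab assms unfolding S_labeled_digraph_def by blast
  from theI'[OF this] show "edge_at \<Gamma> s v \<in> arcs G" "label \<Gamma> (edge_at \<Gamma> s v) = s"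
    "tail G (edge_at \<Gamma> s v) = v \<or> head G (edge_at \<Gamma> s v) = v"
    unfolding edge_at_def by auto
qed

lemma edge_at_eq:
  assumes "e \<in> arcs G" "tail G e = v \<or> head G e = v"
  shows "edge_at \<Gamma> (label \<Gamma> e) v = e"
proof -
  have "label \<Gamma> e \<in> S" "v \<in> V" using lab assms unfolding S_labeled_digraph_def by auto
  then have "\<exists>!e'. e' \<in> arcs G \<and> label \<Gamma> e' = label \<Gamma> e \<and> (tail G e' = v \<or> head G e' = v)"
    using lab unfolding S_labeled_digraph_def by blast
  then show ?thesis unfolding edge_at_def by (rule the1_equality) (use assms in auto)
qed

lemma edge_at_partner:
  assumes "s \<in> S" "v \<in> V" shows "edge_at \<Gamma> s (partner s v) = edge_at \<Gamma> s v"
  using edge_at_eq[of "edge_at \<Gamma> s v" "partner s v"] edge_at[OF assms]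
  unfolding partner_def by auto

sublocale oriented_matchings S V partner out solid_at
proof
  fix s v assume sv: "s \<in> S" "v \<in> V"
  note e = edge_at[OF sv] no_loops[OF edge_at(1)[OF sv]]
  show "partner s v \<in> V" using e unfolding partner_def by auto
  show "partner s (partner s v) = v"
    unfolding partner_def[of s "partner s v"] edge_at_partner[OF sv]
    using e unfolding partner_def by auto
  show "out s (partner s v) \<longleftrightarrow> \<not> out s v"
    unfolding out_def edge_at_partner[OF sv] using e unfolding partner_def by auto
  show "solid_at s (partner s v) \<longleftrightarrow> solid_at s v"
    unfolding solid_at_def edge_at_partner[OF sv] ..
qed

lemma head_map_edge: "s \<in> S \<Longrightarrow> v \<in> V \<Longrightarrow> head_map s v = head G (edge_at \<Gamma> s v)"
  using edge_at(3)[of s v] unfolding head_map_def out_def partner_def by auto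

lemma tau_vertex_outside:
  assumes "s \<in> S" "\<alpha> \<in> V" "\<gamma> \<noteq> \<alpha>" "\<gamma> \<noteq> partner s \<alpha>"
  shows "tau_vertex \<Gamma> s \<alpha> \<gamma> = 0"
  using assms edge_at(3)[of s \<alpha>]
  by (auto simp: tau_vertex_def Let_def basis_vec_def partner_def split: if_splits)

lemma tau_vertex_self:
  assumes "s \<in> S" "\<alpha> \<in> V"
  shows "tau_vertex \<Gamma> s \<alpha> \<alpha> =
    (if solid_at s \<alpha> then if out s \<alpha> then 0 else uu\<^sup>2 - 1
     else if out s \<alpha> then uu else uu\<^sup>2 - uu - 1)"
  using assms edge_at(1,3)[of s \<alpha>] no_loops[of "edge_at \<Gamma> s \<alpha>"]
  by (auto simp: tau_vertex_def Let_def basis_vec_def solid_at_def out_def)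

lemma tau_vertex_partner:
  assumes "s \<in> S" "\<alpha> \<in> V"
  shows "tau_vertex \<Gamma> s \<alpha> (partner s \<alpha>) =
    (if solid_at s \<alpha> then if out s \<alpha> then 1 else uu\<^sup>2
     else if out s \<alpha> then uu + 1 else uu\<^sup>2 - uu)"
  using assms edge_at(1,3)[of s \<alpha>] no_loops[of "edge_at \<Gamma> s \<alpha>"]
  by (auto simp: tau_vertex_def Let_def basis_vec_def solid_at_def out_def partner_def)

text \<open>In the sum that defines \<open>\<tau>\<^sub>s f\<close> at \<open>\<gamma>\<close>, only \<open>\<gamma>\<close> and the vertex matched with it can contribute.\<close>

lemma tau_eq_opr:
  assumes s: "s \<in> S" and f: "f \<in> carrier (M_of \<Gamma>)"
  shows "tau \<Gamma> s f = opr uu s f"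
proof
  fix \<gamma>
  have fin: "finite {\<alpha>. f \<alpha> \<noteq> 0}" and V: "{\<alpha>. f \<alpha> \<noteq> 0} \<subseteq> V"
    using f unfolding M_of_def free_space_def by auto
  have tau: "tau \<Gamma> s f \<gamma> = (\<Sum>\<alpha> | f \<alpha> \<noteq> 0. f \<alpha> * tau_vertex \<Gamma> s \<alpha> \<gamma>)"
    using f by (simp add: tau_def)
  show "tau \<Gamma> s f \<gamma> = opr uu s f \<gamma>"
  proof (cases "\<gamma> \<in> V")
    case False
    have "f \<alpha> * tau_vertex \<Gamma> s \<alpha> \<gamma> = 0" if "f \<alpha> \<noteq> 0" for \<alpha>
    proof -
      have a: "\<alpha> \<in> V" using that V by auto
      then have "\<gamma> \<noteq> \<alpha>" "\<gamma> \<noteq> partner s \<alpha>" using False partner_closed[OF s a] by auto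
      then show ?thesis using tau_vertex_outside[OF s a] by simp
    qed
    then show ?thesis unfolding tau using False by (simp add: matching_op_def)
  next
    case True
    have ne: "partner s \<gamma> \<noteq> \<gamma>" using out_partner[OF s True] by metis
    have pV: "partner s \<gamma> \<in> V" using s True by simp
    have "(\<Sum>\<alpha> | f \<alpha> \<noteq> 0. f \<alpha> * tau_vertex \<Gamma> s \<alpha> \<gamma>) =
        (\<Sum>\<alpha>\<in>{\<gamma>, partner s \<gamma>}. f \<alpha> * tau_vertex \<Gamma> s \<alpha> \<gamma>)"
    proof (rule sum.mono_neutral_cong)
      fix \<alpha> assume "\<alpha> \<in> {\<alpha>. f \<alpha> \<noteq> 0} - {\<gamma>, partner s \<gamma>}"
      then have a: "\<alpha> \<in> V" "\<gamma> \<noteq> \<alpha>" "\<gamma> \<noteq> partner s \<alpha>" using V s by auto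
      then show "f \<alpha> * tau_vertex \<Gamma> s \<alpha> \<gamma> = 0" using tau_vertex_outside[OF s] by simp
    qed (use fin in auto)
    also have "\<dots> = f \<gamma> * tau_vertex \<Gamma> s \<gamma> \<gamma> + f (partner s \<gamma>) * tau_vertex \<Gamma> s (partner s \<gamma>) \<gamma>"
      using ne by simp
    finally show ?thesis
      using tau_vertex_self[OF s True] tau_vertex_partner[OF s pV] s True
      unfolding tau by (auto simp: matching_op_def)
  qed
qed

end

section \<open>Acyclicity and the count of sources and sinks\<close>

text \<open>A labeled digraph whose operators depend, along reduced words, only on the element of \<open>W\<close>; this is
  what remains of a representation of the Hecke algebra.\<close>

locale hecke_digraph = sign_group W S + labeled S \<Gamma>
  for W :: "('w, 'm) monoid_scheme" (structure) and S :: "'w set"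
    and \<Gamma> :: "('v, 'e, 'w) labeled_digraph" +
  assumes finite_group: "finite (carrier W)"
    and opr_reduced: "reduced ss \<Longrightarrow> reduced ts \<Longrightarrow> wprod ss = wprod ts \<Longrightarrow> f \<in> carrier (M_of \<Gamma>) \<Longrightarrow>
      foldr (opr uu) ss f = foldr (opr uu) ts f"
begin

lemma carrier_M: "f \<in> carrier (M_of \<Gamma>) \<longleftrightarrow> finite {v. f v \<noteq> 0} \<and> {v. f v \<noteq> 0} \<subseteq> V"
  by (simp add: M_of_def free_space_def)

lemma unit_vector_carrier: "\<alpha> \<in> V \<Longrightarrow> (\<lambda>\<beta>. if \<beta> = \<alpha> then 1 else 0) \<in> carrier (M_of \<Gamma>)"
  unfolding carrier_M by (auto intro: finite_subset[of _ "{\<alpha>}"])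

lemma opr_carrier: "s \<in> S \<Longrightarrow> f \<in> carrier (M_of \<Gamma>) \<Longrightarrow> opr z s f \<in> carrier (M_of \<Gamma>)"
  unfolding carrier_M using finite_support_matching_op[of s f z] by blast

lemma rev_op_carrier: "s \<in> S \<Longrightarrow> f \<in> carrier (M_of \<Gamma>) \<Longrightarrow> rev_op z s f \<in> carrier (M_of \<Gamma>)"
  unfolding carrier_M using oriented_matchings.finite_support_matching_op[OF reversed, of s f z] by blast

lemma rev_word_carrier:
  "set ss \<subseteq> S \<Longrightarrow> f \<in> carrier (M_of \<Gamma>) \<Longrightarrow> foldr (rev_op z) ss f \<in> carrier (M_of \<Gamma>)"
  by (induction ss) (auto intro: rev_op_carrier)

lemma word_inverse:
  assumes "set ss \<subseteq> S" "f \<in> carrier (M_of \<Gamma>)"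
  shows "foldr (opr uu) (rev ss) (foldr (rev_op (- inverse uu)) ss f) = f"
    and "foldr (rev_op (- inverse uu)) ss (foldr (opr uu) (rev ss) f) = f"
proof -
  have z: "opr uu s (rev_op (- inverse uu) s g) = g" "rev_op (- inverse uu) s (opr uu s g) = g"
    if "s \<in> S" "g \<in> carrier (M_of \<Gamma>)" for s g
    using that by (auto intro!: opr_rev_op uu_nonzero simp: carrier_M)
  show "foldr (opr uu) (rev ss) (foldr (rev_op (- inverse uu)) ss f) = f"
    using assms by (induction ss) (auto simp: z rev_word_carrier)
  show "foldr (rev_op (- inverse uu)) ss (foldr (opr uu) (rev ss) f) = f"
    using assms
  proof (induction ss arbitrary: f)
    case (Cons s ss)
    have "set ss \<subseteq> S" "s \<in> S" "opr uu s f \<in> carrier (M_of \<Gamma>)"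
      using Cons.prems opr_carrier[of s f uu] by auto
    then show ?case using Cons.IH[of "opr uu s f"] Cons.prems(2) by (simp add: z)
  qed simp
qed

text \<open>The reversed operators inherit the property since a product of inverses is the inverse of the
  product in reversed order, and reversed words are reduced words of the inverse element.\<close>

lemma rev_op_reduced:
  assumes "reduced ss" "reduced ts" "wprod ss = wprod ts" "f \<in> carrier (M_of \<Gamma>)"
  shows "foldr (rev_op (- inverse uu)) ss f = foldr (rev_op (- inverse uu)) ts f"
proof -
  let ?g = "foldr (rev_op (- inverse uu)) ss f"
  have g: "?g \<in> carrier (M_of \<Gamma>)" using assms by (simp add: rev_word_carrier)
  have "wprod (rev ss) = wprod (rev ts)" using assms by (simp add: wprod_rev)
  then have "foldr (opr uu) (rev ts) ?g = foldr (opr uu) (rev ss) ?g"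
    using opr_reduced reduced_rev assms(1,2) g by metis
  also have "\<dots> = f" using assms by (simp add: word_inverse)
  finally show ?thesis
    using word_inverse(2)[of ts ?g] g assms(2) by simp
qed

interpretation at_zero: reduced_matchings S V partner out solid_at "range (\<lambda>p. Fract p 1)" uu
  by (intro reduced_matchings.intro subring_at_zero oriented_matchings_axioms)

interpretation at_infinity: reduced_matchings S V partner "\<lambda>s v. \<not> out s v" solid_at
    regular_at_infinity "- inverse uu"
  by (intro reduced_matchings.intro subring_at_infinity reversed)

sublocale heads: zero_hecke_action W S V head_map
proof
  show "finite (carrier W)" by (rule finite_group)
  fix s v assume "s \<in> S" "v \<in> V"
  then show "head_map s (head_map s v) = head_map s v" by (simp add: head_map_def)
next
  fix ss ts v assume "reduced ss" "reduced ts" "wprod ss = wprod ts" "v \<in> V"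
  then show "foldr head_map ss v = foldr head_map ts v"
    by (intro at_zero.head_words_eq opr_reduced unit_vector_carrier) auto
qed auto

abbreviation tail_map :: "'w \<Rightarrow> 'v \<Rightarrow> 'v" where
  "tail_map \<equiv> at_infinity.head_map"

sublocale tails: zero_hecke_action W S V "oriented_matchings.head_map partner (\<lambda>s v. \<not> out s v)"
proof
  show "finite (carrier W)" by (rule finite_group)
  fix s v assume "s \<in> S" "v \<in> V"
  then show "tail_map s (tail_map s v) = tail_map s v" by (simp add: at_infinity.head_map_def)
next
  fix ss ts v assume "reduced ss" "reduced ts" "wprod ss = wprod ts" "v \<in> V"
  then show "foldr tail_map ss v = foldr tail_map ts v"
    by (intro at_infinity.head_words_eq rev_op_reduced unit_vector_carrier) auto
qed auto

lemma tail_map_edge: "s \<in> S \<Longrightarrow> v \<in> V \<Longrightarrow> tail_map s v = tail G (edge_at \<Gamma> s v)"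
  using edge_at(3)[of s v] unfolding at_infinity.head_map_def by (auto simp: out_def partner_def)

lemma label_mem: "e \<in> arcs G \<Longrightarrow> label \<Gamma> e \<in> S"
  using lab unfolding S_labeled_digraph_def by auto

lemma head_map_arc:
  assumes "e \<in> arcs G"
  shows "head_map (label \<Gamma> e) (tail G e) = head G e" "tail_map (label \<Gamma> e) (head G e) = tail G e"
  using assms label_mem[OF assms] by (simp_all add: head_map_edge tail_map_edge edge_at_eq)

text \<open>Each edge of a directed walk moves its tail, so the labels along the walk form a reduced word. It
  is read backwards, because \<open>foldr\<close> lets the last letter act first; \<open>ss\<close> collects the steps that lead
  from \<open>x\<close> to the current vertex.\<close>

lemma walk_reduced_word:
  assumes "cas u es v" "set es \<subseteq> arcs G" "u \<in> V"
    "reduced ss" "foldr head_map ss x = u" "x \<in> V"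
  shows "\<exists>ts. reduced ts \<and> length ts = length es + length ss \<and> foldr head_map ts x = v"
  using assms
proof (induction es arbitrary: u ss)
  case Nil
  then show ?case by auto
next
  case (Cons e es)
  have e: "e \<in> arcs G" "tail G e = u" using Cons.prems by auto
  have step: "head_map (label \<Gamma> e) u = head G e" using head_map_arc(1)[OF e(1)] e(2) by simp
  then have "reduced (label \<Gamma> e # ss)"
    using Cons.prems no_loops[OF e(1)] e label_mem[OF e(1)]
    by (intro heads.moving_word_reduced[of _ _ x]) auto
  then obtain ts where "reduced ts" "length ts = length es + length (label \<Gamma> e # ss)"
      "foldr head_map ts x = v"
    using Cons.IH[of "head G e" "label \<Gamma> e # ss"] Cons.prems step e by auto
  then show ?case by auto
qed

lemma acyclic: "acyclic_digraph G"
  unfolding acyclic_digraph_def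
proof
  assume "\<exists>u p. awalk u p u \<and> p \<noteq> []"
  then obtain u p where p: "awalk u p u" "p \<noteq> []" by blast
  have rep: "cas u (concat (replicate m p)) u" "set (concat (replicate m p)) \<subseteq> arcs G" for m
    using p by (induction m) (auto simp: cas_append_iff awalk_def)
  \<comment> \<open>a circuit can be repeated until it is longer than every reduced word\<close>
  let ?m = "Suc (length heads.longest)"
  obtain ts where "reduced ts" "length ts = length (concat (replicate ?m p)) + length ([] :: 'w list)"
    using walk_reduced_word[OF rep[of ?m] _ reduced_Nil, of u] p by (auto simp: awalk_def)
  then have "length ts = ?m * length p" "length ts \<le> length heads.longest"
    using heads.longest_max[of ts] by (simp_all only: length_concat map_replicate sum_list_replicate) simp_all
  moreover have "?m \<le> ?m * length p" using p by (cases p) auto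
  ultimately show False by (metis Suc_n_not_le_n le_trans)
qed

lemma reachable_maps:
  assumes "s \<in> S" "v \<in> V"
  shows "reachable (with_proj (mk_symmetric G)) v (head_map s v)"
    "reachable (with_proj (mk_symmetric G)) v (tail_map s v)"
proof -
  interpret M: pair_wf_digraph "mk_symmetric G" by (rule wellformed_mk_symmetric)
  have "(v, partner s v) \<in>
      (let e = edge_at \<Gamma> s v in {(tail G e, head G e), (head G e, tail G e)})"
    using edge_at(3)[OF assms] by (auto simp: partner_def Let_def)
  then have "(v, partner s v) \<in> parcs (mk_symmetric G)"
    unfolding parcs_mk_symmetric Let_def by (intro UN_I[OF edge_at(1)[OF assms]])
  then have "reachable (with_proj (mk_symmetric G)) v (partner s v)" by (intro M.reachable_adjI) simp
  moreover have "reachable (with_proj (mk_symmetric G)) v v" using assms by (intro M.reachable_refl) simp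
  ultimately show "reachable (with_proj (mk_symmetric G)) v (head_map s v)"
    "reachable (with_proj (mk_symmetric G)) v (tail_map s v)"
    by (auto simp: head_map_def at_infinity.head_map_def)
qed

lemma sinks_eq: "sinks G = {v \<in> V. \<forall>s\<in>S. head_map s v = v}"
proof (intro equalityI subsetI)
  fix v assume "v \<in> sinks G"
  then have v: "v \<in> V" "\<And>e. e \<in> arcs G \<Longrightarrow> tail G e \<noteq> v" by (auto simp: sinks_def out_arcs_def)
  then show "v \<in> {v \<in> V. \<forall>s\<in>S. head_map s v = v}"
    using edge_at(1,3)[OF _ v(1)] v(2) head_map_edge[OF _ v(1)] v(1) by fastforce
next
  fix v assume v: "v \<in> {v \<in> V. \<forall>s\<in>S. head_map s v = v}"
  have "tail G e \<noteq> v" if e: "e \<in> arcs G" for e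
    using v head_map_arc(1)[OF e] label_mem[OF e] no_loops[OF e] by auto
  then show "v \<in> sinks G" using v by (auto simp: sinks_def out_arcs_def)
qed

lemma sources_eq: "sources G = {v \<in> V. \<forall>s\<in>S. tail_map s v = v}"
proof (intro equalityI subsetI)
  fix v assume "v \<in> sources G"
  then have v: "v \<in> V" "\<And>e. e \<in> arcs G \<Longrightarrow> head G e \<noteq> v" by (auto simp: sources_def in_arcs_def)
  then show "v \<in> {v \<in> V. \<forall>s\<in>S. tail_map s v = v}"
    using edge_at(1,3)[OF _ v(1)] v(2) tail_map_edge[OF _ v(1)] v(1) by fastforce
next
  fix v assume v: "v \<in> {v \<in> V. \<forall>s\<in>S. tail_map s v = v}"
  have "head G e \<noteq> v" if e: "e \<in> arcs G" for e
    using v head_map_arc(2)[OF e] label_mem[OF e] no_loops[OF e] by auto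
  then show "v \<in> sources G" using v by (auto simp: sources_def in_arcs_def)
qed

lemma card_sinks: "card (sinks G) = card (components G)"
  unfolding sinks_eq
proof (rule heads.card_fixed_points[OF wf_digraph HOL.refl _ reachable_maps(1)])
  fix e assume e: "e \<in> arcs G"
  show "\<exists>s\<in>S. head_map s (tail G e) = head G e \<or> head_map s (head G e) = tail G e"
    using head_map_arc(1)[OF e] label_mem[OF e] by blast
qed

lemma card_sources: "card (sources G) = card (components G)"
  unfolding sources_eq
proof (rule tails.card_fixed_points[OF wf_digraph HOL.refl _ reachable_maps(2)])
  fix e assume e: "e \<in> arcs G"
  show "\<exists>s\<in>S. tail_map s (tail G e) = head G e \<or> tail_map s (head G e) = tail G e"
    using head_map_arc(2)[OF e] label_mem[OF e] by blast
qed

end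

context sign_group begin

text \<open>Every suffix of a reduced word is reduced, so each letter multiplies by the length-increasing rule.
  The empty word is excluded since the rules do not force \<open>T \<one>\<close> to be the unit: if \<open>S\<close> is empty, it can
  be any nonzero multiple of the unit.\<close>

lemma hecke_word:
  assumes H: "is_hecke_algebra W S H T"
    and \<rho>: "\<rho> \<in> algebra_hom Qu H (End_algebra Qu (M_of \<Gamma>))" "\<And>s. s \<in> S \<Longrightarrow> \<rho> (T s) = tau \<Gamma> s"
    and ss: "reduced ss" "ss \<noteq> []" and f: "f \<in> carrier (M_of \<Gamma>)"
  shows "\<rho> (T (wprod ss)) f = foldr (tau \<Gamma>) ss f"
  using ss
proof (induction ss)
  case (Cons s ss)
  have s: "s \<in> S" and red: "reduced ss"
    using reducedD[OF Cons.prems(1)] reduced_Cons_tail[OF Cons.prems(1)] by auto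
  show ?case
  proof (cases "ss = []")
    case True
    then show ?thesis using s \<rho>(2) by simp
  next
    case False
    have T: "T w \<in> carrier H" if "w \<in> carrier W" for w
      using H that unfolding is_hecke_algebra_def is_basis_def by auto
    have w: "wprod ss \<in> carrier W" using red by simp
    have "T s \<otimes>\<^bsub>H\<^esub> T (wprod ss) = T (s \<otimes> wprod ss)"
      using H s w reduced_Cons_length[OF Cons.prems(1)] unfolding is_hecke_algebra_def by simp
    moreover have "\<rho> (T s \<otimes>\<^bsub>H\<^esub> T (wprod ss)) =
        \<rho> (T s) \<otimes>\<^bsub>End_algebra Qu (M_of \<Gamma>)\<^esub> \<rho> (T (wprod ss))"
      using \<rho>(1) T s w by (intro ring_hom_mult) (auto simp: algebra_hom_def)
    ultimately have "\<rho> (T (wprod (s # ss))) f =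
        (\<rho> (T s) \<otimes>\<^bsub>End_algebra Qu (M_of \<Gamma>)\<^esub> \<rho> (T (wprod ss))) f"
      by simp
    also have "\<dots> = tau \<Gamma> s (\<rho> (T (wprod ss)) f)"
      using f \<rho>(2)[OF s] by (simp add: End_algebra_def)
    finally show ?thesis using Cons.IH[OF red False] by simp
  qed
qed simp

lemma W_digraph_hecke_digraph:
  assumes H: "is_hecke_algebra W S H T" and \<Gamma>: "W_digraph S H T \<Gamma>" and fin: "finite (carrier W)"
  shows "hecke_digraph W S \<Gamma>"
proof -
  interpret labeled S \<Gamma> using \<Gamma> by unfold_locales (simp add: W_digraph_def)
  obtain \<rho> where \<rho>: "\<rho> \<in> algebra_hom Qu H (End_algebra Qu (M_of \<Gamma>))" "\<And>s. s \<in> S \<Longrightarrow> \<rho> (T s) = tau \<Gamma> s"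
    using \<Gamma> unfolding W_digraph_def by blast
  show ?thesis
  proof
    show "finite (carrier W)" by (rule fin)
    fix ss ts f
    assume red: "reduced ss" "reduced ts" and eq: "wprod ss = wprod ts" and f: "f \<in> carrier (M_of \<Gamma>)"
    have word: "foldr (opr uu) us f = foldr (tau \<Gamma>) us f \<and> foldr (opr uu) us f \<in> carrier (M_of \<Gamma>)"
      if "set us \<subseteq> S" for us
      using that
    proof (induction us)
      case (Cons s us)
      then have s: "s \<in> S" and c: "foldr (opr uu) us f \<in> carrier (M_of \<Gamma>)"
        and IH: "foldr (tau \<Gamma>) us f = foldr (opr uu) us f" by auto
      have "opr uu s (foldr (opr uu) us f) \<in> carrier (M_of \<Gamma>)"
        using finite_support_matching_op[OF s, of "foldr (opr uu) us f" uu] c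
        by (simp add: M_of_def free_space_def)
      then show ?case using tau_eq_opr[OF s c] by (simp add: IH)
    qed (use f in simp)
    have len: "length ss = length ts" using red eq by (simp add: reduced_def)
    show "foldr (opr uu) ss f = foldr (opr uu) ts f"
    proof (cases "ss = []")
      case False
      then have "ts \<noteq> []" using len by auto
      then show ?thesis
        using hecke_word[OF H \<rho> red(1) False f] hecke_word[OF H \<rho> red(2) _ f] eq
          word[OF reducedD[OF red(1)]] word[OF reducedD[OF red(2)]] by simp
    qed (use len in simp)
  qed
qed

end

theorem corollary1p6:
  fixes W :: "('w, 'm) monoid_scheme"
    and S :: "'w set"
    and n :: "'w \<Rightarrow> 'w \<Rightarrow> enat"
    and H :: "(ratfun, 'h, 'n) module_scheme"
    and T :: "'w \<Rightarrow> 'h"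
  assumes "coxeter_system W S n"
    and "is_hecke_algebra W S H T"
    and "finite (carrier W)"
  shows "(\<forall>\<Gamma> :: ('v, 'e, 'w) labeled_digraph.
            W_digraph S H T \<Gamma> \<longrightarrow> acyclic_digraph (graph_of \<Gamma>)) \<and>
         (\<forall>\<Gamma> :: ('v, 'e, 'w) labeled_digraph.
            W_digraph S H T \<Gamma> \<and> finite (verts (graph_of \<Gamma>)) \<longrightarrow>
              card (sources (graph_of \<Gamma>)) = card (components (graph_of \<Gamma>)) \<and>
              card (sinks (graph_of \<Gamma>)) = card (components (graph_of \<Gamma>)))"
proof -
  interpret sign_group W S using assms(1) by (rule coxeter_system_sign_group)
  have "hecke_digraph W S \<Gamma>" if "W_digraph S H T \<Gamma>" for \<Gamma> :: "('v, 'e, 'w) labeled_digraph"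
    using W_digraph_hecke_digraph[OF assms(2) that assms(3)] .
  then show ?thesis
    using hecke_digraph.acyclic hecke_digraph.card_sources hecke_digraph.card_sinks by blast
qed

end
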